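(* Let $T$ be any right triangle (with its legs designated as long leg $b$ and short leg $a$, and hypotenuse $c$). Then there exist tilings of the plane by right triangles similar to $T$ such that any finite set of tiles lies in a supertile (made of tiles of the tiling), and such that the areas of the tiles are bounded both above and below (i.e. bounded above by a finite constant and below by a positive constant).
   Context: Fix positive reals $a,b,c$ with $a^2+b^2=c^2$ and let $\theta=\arcsin(a/c)\in(0,\pi/2)$. A tile is a right triangle with an ordered triple of vertices $(A,C,B)$, with right angle at $C$ and angle $\theta$ at $A$, so that $|AC|:|CB|:|AB|=b:a:c$. $AC$ is called the long leg and $CB$ the short leg (even if $b\le a$). Subdivision rule: let $F$ be the foot of the perpendicular from $C$ to $AB$, and let $M,N,K$ be the midpoints of $AC$, $AF$, $FC$. The tile $(A,C,B)$ is divided into the five daughter tiles $(A,N,M)$, $(M,K,C)$, $(M,K,F)$, $(F,N,M)$ (each smaller than the parent by the linear factor $b/(2c)$) and $(C,F,B)$ (smaller by the linear factor $a/c$). Let $T$ be the basic tile with hypotenuse $c$. Put $T_0=\{T\}$, and for $n\ge1$ let $T_n$ be obtained from $T_{n-1}$ by subdividing every tile of $T_{n-1}$ that has the largest hypotenuse occurring in $T_{n-1}$. A supertile of order $n$ is a collection of tiles of the form $e(s(T_n))$, where $s$ is a rescaling and $e$ is a Euclidean motion (possibly orientation reversing). *)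

theory Defs
  imports "HOL-Analysis.Analysis"
begin

type_synonym point = "real ^ 2"

text \<open>A tile is the ordered triple \<open>(A, C, B)\<close> of its vertices, with the right angle at the middle
  entry. The order matters: it is what designates \<open>AC\<close> as the long leg.\<close>

type_synonym tile = "point \<times> point \<times> point"

definition angle_at :: "point \<Rightarrow> point \<Rightarrow> point \<Rightarrow> real" where
  "angle_at P Q R = arccos ((Q - P) \<bullet> (R - P) / (dist P Q * dist P R))"

fun is_tile :: "real \<Rightarrow> real \<Rightarrow> real \<Rightarrow> tile \<Rightarrow> bool" where
  "is_tile a b c (A, C, B) \<longleftrightarrow>
     angle_at C A B = pi / 2 \<and> angle_at A C B = arcsin (a / c) \<and>
     (\<exists>k>0. dist A C = k * b \<and> dist C B = k * a \<and> dist A B = k * c)"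

fun region :: "tile \<Rightarrow> point set" where
  "region (A, C, B) = convex hull {A, C, B}"

fun hypotenuse :: "tile \<Rightarrow> real" where
  "hypotenuse (A, C, B) = dist A B"

definition foot :: "point \<Rightarrow> point \<Rightarrow> point \<Rightarrow> point" where
  "foot C A B = (THE F. F \<in> affine hull {A, B} \<and> (C - F) \<bullet> (B - A) = 0)"

lemma foot_eq:
  assumes "A \<noteq> B"
  shows "foot C A B = A + ((C - A) \<bullet> (B - A) / ((B - A) \<bullet> (B - A))) *\<^sub>R (B - A)"
proof -
  have pos: "(B - A) \<bullet> (B - A) \<noteq> 0"
    using assms by simp
  have line: "F \<in> affine hull {A, B} \<longleftrightarrow> (\<exists>t. F = A + t *\<^sub>R (B - A))" for F
    by (simp add: affine_hull_2_alt image_iff)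
  have perp: "(C - (A + t *\<^sub>R (B - A))) \<bullet> (B - A) = (C - A) \<bullet> (B - A) - t * ((B - A) \<bullet> (B - A))" for t
    by (simp add: inner_diff_left inner_add_left)
  show ?thesis
    unfolding foot_def line
  proof (rule the_equality)
    show "(\<exists>t. A + ((C - A) \<bullet> (B - A) / ((B - A) \<bullet> (B - A))) *\<^sub>R (B - A) = A + t *\<^sub>R (B - A)) \<and>
        (C - (A + ((C - A) \<bullet> (B - A) / ((B - A) \<bullet> (B - A))) *\<^sub>R (B - A))) \<bullet> (B - A) = 0"
      unfolding perp using pos by auto
  next
    fix F assume F: "(\<exists>t. F = A + t *\<^sub>R (B - A)) \<and> (C - F) \<bullet> (B - A) = 0"
    then obtain t where t: "F = A + t *\<^sub>R (B - A)" by blast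
    have "t * ((B - A) \<bullet> (B - A)) = (C - A) \<bullet> (B - A)"
      using F perp[of t] unfolding t by linarith
    then have "t = (C - A) \<bullet> (B - A) / ((B - A) \<bullet> (B - A))"
      using pos by (metis nonzero_mult_div_cancel_right)
    then show "F = A + ((C - A) \<bullet> (B - A) / ((B - A) \<bullet> (B - A))) *\<^sub>R (B - A)"
      unfolding t by simp
  qed
qed

fun daughters :: "tile \<Rightarrow> tile set" where
  "daughters (A, C, B) =
     (let F = foot C A B; M = midpoint A C; N = midpoint A F; K = midpoint F C
      in {(A, N, M), (M, K, C), (M, K, F), (F, N, M), (C, F, B)})"

definition subdivide_largest :: "tile set \<Rightarrow> tile set" where
  "subdivide_largest \<T> =
     (\<Union>t\<in>\<T>. if hypotenuse t = Max (hypotenuse ` \<T>) then daughters t else {t})"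

text \<open>The position of the basic tile is immaterial, since supertiles are taken up to
  rescaling and Euclidean motions. If \<open>a\<^sup>2 + b\<^sup>2 = c\<^sup>2\<close>, its hypotenuse is \<open>c\<close>.\<close>

definition basic_tile :: "real \<Rightarrow> real \<Rightarrow> tile" where
  "basic_tile a b = (vector [b, 0], vector [0, 0], vector [0, a])"

primrec T_seq :: "real \<Rightarrow> real \<Rightarrow> nat \<Rightarrow> tile set" where
  "T_seq a b 0 = {basic_tile a b}"
| "T_seq a b (Suc n) = subdivide_largest (T_seq a b n)"

fun map_tile :: "(point \<Rightarrow> point) \<Rightarrow> tile \<Rightarrow> tile" where
  "map_tile f (A, C, B) = (f A, f C, f B)"

text \<open>A distance-preserving self-map of the plane is automatically bijective, so the maps below
  are exactly the Euclidean motions, orientation-reversing ones included.\<close>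

definition euclidean_motion :: "(point \<Rightarrow> point) \<Rightarrow> bool" where
  "euclidean_motion e \<longleftrightarrow> (\<forall>x y. dist (e x) (e y) = dist x y)"

definition supertile :: "real \<Rightarrow> real \<Rightarrow> nat \<Rightarrow> tile set \<Rightarrow> bool" where
  "supertile a b n Y \<longleftrightarrow>
     (\<exists>e r. euclidean_motion e \<and> r > 0 \<and> Y = map_tile (\<lambda>x. e (r *\<^sub>R x)) ` T_seq a b n)"

definition tiling_of_plane :: "tile set \<Rightarrow> bool" where
  "tiling_of_plane X \<longleftrightarrow>
     (\<Union>t\<in>X. region t) = UNIV \<and>
     pairwise (\<lambda>s t. interior (region s) \<inter> interior (region t) = {}) X"

end

theory Submission
  imports Defs
begin

text \<open>Subdividing a tile recursively as long as the hypotenuse exceeds a threshold \<open>s\<close> is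
  compatible with similarities and with passing from a tile to its descendants. Every \<open>T\<^sub>n\<close> is such a
  subdivision of the basic tile, and every threshold gives some \<open>T\<^sub>n\<close>, since the largest hypotenuses
  strictly decrease through the values \<open>c (b/2c)\<^sup>i (a/c)\<^sup>j\<close>, only finitely many of which exceed a given
  positive number. As the leaves become arbitrarily small, some leaf lies strictly inside the basic tile;
  transported by similarities, this exhibits every tile \<open>t\<close> as a descendant of a tile that contains
  a neighbourhood of \<open>t\<close> of width proportional to the size of \<open>t\<close>. Iterating gives tiles exhausting
  the plane whose subdivisions at the fixed threshold \<open>c\<close> are nested supertiles, and their union is the
  tiling.\<close>

section \<open>Recursive subdivision down to a threshold\<close>

text \<open>\<open>leaf s t u\<close>: the subdivision of \<open>t\<close> with threshold \<open>s\<close> contains \<open>u\<close>.\<close>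

inductive leaf :: "real \<Rightarrow> tile \<Rightarrow> tile \<Rightarrow> bool" for s where
  stop: "hypotenuse t \<le> s \<Longrightarrow> leaf s t t"
| split: "hypotenuse t > s \<Longrightarrow> d \<in> daughters t \<Longrightarrow> leaf s d u \<Longrightarrow> leaf s t u"

lemma leaf_small: "leaf s t u \<Longrightarrow> hypotenuse u \<le> s"
  by (induction rule: leaf.induct) auto

lemma leaf_of_small: "hypotenuse t \<le> s \<Longrightarrow> leaf s t u \<longleftrightarrow> u = t"
  by (auto intro: leaf.stop elim: leaf.cases)

lemma leaf_of_large:
  "hypotenuse t > s \<Longrightarrow> leaf s t u \<longleftrightarrow> (\<exists>d\<in>daughters t. leaf s d u)"
  by (auto intro: leaf.split elim: leaf.cases)

text \<open>Every tile split on the way from \<open>t\<close> to \<open>u\<close> is larger than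
  \<open>s\<close>, hence larger than \<open>r\<close>, so the finer subdivision makes the same cuts
  and then continues inside \<open>u\<close>. This is what makes the successive patches of the
  tiling nested.\<close>

lemma leaf_trans:
  assumes "leaf s t u" "leaf r u v" "r \<le> s"
  shows "leaf r t v"
  using assms by (induction rule: leaf.induct) (auto intro: leaf.split)

section \<open>Cutting a triangle along a segment from a vertex\<close>

lemma mem_triangle:
  "x \<in> convex hull {P, Q, R} \<longleftrightarrow>
    (\<exists>l m n. l \<ge> 0 \<and> m \<ge> 0 \<and> n \<ge> 0 \<and> l + m + n = 1 \<and> x = l *\<^sub>R P + m *\<^sub>R Q + n *\<^sub>R R)"
  unfolding convex_hull_3 by blast

text \<open>The segment from \<open>P\<close> to a point \<open>D\<close> strictly between
  \<open>Q\<close> and \<open>R\<close> cuts the triangle in two. The whole subdivision rule is a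
  composition of such cuts.\<close>

lemma triangle_cut:
  fixes P Q R :: point
  assumes "0 < v" "v < 1" and D: "D = Q + v *\<^sub>R (R - Q)"
  shows "convex hull {P, Q, R} = convex hull {P, Q, D} \<union> convex hull {P, D, R}"
    and "interior (convex hull {P, Q, D}) \<inter> interior (convex hull {P, D, R}) = {}"
proof -
  let ?T = "convex hull {P, Q, R}"
  have "D = (1 - v) *\<^sub>R Q + v *\<^sub>R R"
    by (simp add: D algebra_simps)
  then have DT: "D \<in> ?T"
    using assms(1,2) convexD[OF convex_convex_hull[of "{P, Q, R}"], of Q R "1 - v" v]
    by (simp add: hull_inc)
  have sub: "convex hull {P, Q, D} \<union> convex hull {P, D, R} \<subseteq> ?T"
    using DT by (intro Un_least hull_minimal convex_convex_hull) (simp_all add: hull_inc)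
  have "x \<in> convex hull {P, Q, D} \<union> convex hull {P, D, R}" if xT: "x \<in> ?T" for x
  proof -
    obtain l m n where lmn: "l \<ge> 0" "m \<ge> 0" "n \<ge> 0" "l + m + n = 1"
      and x: "x = l *\<^sub>R P + m *\<^sub>R Q + n *\<^sub>R R"
      using xT unfolding mem_triangle by blast
    show ?thesis
    \<comment> \<open>The inequality decides on which side of the line \<open>PD\<close> the point
      lies. Since \<open>D\<close> is \<open>1 - v\<close> parts \<open>Q\<close> and
      \<open>v\<close> parts \<open>R\<close>, on the side of \<open>Q\<close> the weight
      \<open>k = n / v\<close> on \<open>D\<close> absorbs all of \<open>R\<close> and leaves a
      nonnegative weight on \<open>Q\<close>; the other case is symmetric.\<close>
    proof (cases "n * (1 - v) \<le> m * v")
      case True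
      define k where "k = n / v"
      have "k \<ge> 0" "n = k * v" "m - k * (1 - v) \<ge> 0"
        using lmn(1-3) assms(1,2) True by (simp_all add: k_def divide_simps)
      moreover have "x = l *\<^sub>R P + (m - k * (1 - v)) *\<^sub>R Q + k *\<^sub>R D"
        unfolding x D \<open>n = k * v\<close> by (simp add: algebra_simps)
      moreover have "l + (m - k * (1 - v)) + k = 1"
        using lmn(4) \<open>n = k * v\<close> by (simp add: algebra_simps)
      ultimately show ?thesis
        using lmn(1) unfolding Un_iff mem_triangle by blast
    next
      case False
      define k where "k = m / (1 - v)"
      have "k \<ge> 0" "m = k * (1 - v)" "n - k * v \<ge> 0"
        using lmn(1-3) assms(1,2) False by (simp_all add: k_def divide_simps)
      moreover have "x = l *\<^sub>R P + k *\<^sub>R D + (n - k * v) *\<^sub>R R"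
        unfolding x D \<open>m = k * (1 - v)\<close> by (simp add: algebra_simps)
      moreover have "l + k + (n - k * v) = 1"
        using lmn(4) \<open>m = k * (1 - v)\<close> by (simp add: algebra_simps)
      ultimately show ?thesis
        using lmn(1) unfolding Un_iff mem_triangle by blast
    qed
  qed
  then show "?T = convex hull {P, Q, D} \<union> convex hull {P, D, R}"
    using sub by blast
  \<comment> \<open>For disjointness: \<open>w\<close> is normal to the line \<open>PD\<close>, and
    \<open>D\<close> lies between \<open>Q\<close> and \<open>R\<close>, so the offsets of
    \<open>Q\<close> and \<open>R\<close> along \<open>w\<close> have opposite signs or both vanish.
    Then \<open>z\<close> is \<open>w\<close> or \<open>-w\<close>, chosen to put \<open>Q\<close>
    on the nonpositive side, and the two pieces meet only within a line, which has empty
    interior.\<close>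
  obtain w :: point where w: "w \<noteq> 0" "w \<bullet> (D - P) = 0"
    using orthogonal_to_vector_exists[of "D - P"] by (auto simp: orthogonal_def inner_commute)
  have opp: "(1 - v) * (w \<bullet> (Q - P)) + v * (w \<bullet> (R - P)) = 0"
  proof -
    have "D - P = (1 - v) *\<^sub>R (Q - P) + v *\<^sub>R (R - P)"
      unfolding D by (simp add: algebra_simps)
    then show ?thesis
      using w(2) by (simp only: inner_add_right inner_scaleR_right)
  qed
  have "\<exists>z. z \<noteq> 0 \<and> z \<bullet> (D - P) = 0 \<and> z \<bullet> (Q - P) \<le> 0 \<and> z \<bullet> (R - P) \<ge> 0"
  proof (cases "w \<bullet> (Q - P) \<le> 0")
    case True
    then have "(1 - v) * (w \<bullet> (Q - P)) \<le> 0"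
      using assms(2) by (intro mult_nonneg_nonpos) auto
    then have "0 \<le> v * (w \<bullet> (R - P))"
      using opp by linarith
    then have "0 \<le> w \<bullet> (R - P)"
      using assms(1) by (simp only: zero_le_mult_iff) linarith
    then show ?thesis
      using True w by blast
  next
    case False
    then have "0 \<le> (1 - v) * (w \<bullet> (Q - P))"
      using assms(2) by (intro mult_nonneg_nonneg) auto
    then have "v * (w \<bullet> (R - P)) \<le> 0"
      using opp by linarith
    then have "w \<bullet> (R - P) \<le> 0"
      using assms(1) by (simp only: mult_le_0_iff) linarith
    then show ?thesis
      using False w by (intro exI[of _ "- w"]) (simp only: inner_minus_left neg_equal_0_iff_equal; simp)
  qed
  then obtain z where z: "z \<noteq> 0" "z \<bullet> (D - P) = 0" "z \<bullet> (Q - P) \<le> 0" "z \<bullet> (R - P) \<ge> 0"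
    by blast
  have "convex hull {P, Q, D} \<subseteq> {x. z \<bullet> x \<le> z \<bullet> P}"
    using z(2,3) by (intro hull_minimal) (simp_all add: convex_halfspace_le inner_diff_right)
  moreover have "convex hull {P, D, R} \<subseteq> {x. z \<bullet> x \<ge> z \<bullet> P}"
    using z(2,4) by (intro hull_minimal) (simp_all add: convex_halfspace_ge inner_diff_right)
  ultimately have "convex hull {P, Q, D} \<inter> convex hull {P, D, R} \<subseteq> {x. z \<bullet> x = z \<bullet> P}"
    by (auto intro!: antisym)
  then have "interior (convex hull {P, Q, D} \<inter> convex hull {P, D, R})
      \<subseteq> interior {x. z \<bullet> x = z \<bullet> P}"
    by (rule interior_mono)
  then show "interior (convex hull {P, Q, D}) \<inter> interior (convex hull {P, D, R}) = {}"
    using z(1) by simp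
qed

section \<open>Similarities act on tiles and on their subdivisions\<close>

definition similarity :: "real \<Rightarrow> (point \<Rightarrow> point) \<Rightarrow> bool" where
  "similarity r f \<longleftrightarrow> r > 0 \<and> (\<forall>x y. dist (f x) (f y) = r * dist x y)"

text \<open>After moving the image of the origin back to the origin and dividing by
  \<open>r\<close>, an isometry fixing the origin remains, and such a map is automatically linear
  and orthogonal.\<close>

lemma similarity_affine:
  assumes "similarity r f"
  obtains g where "orthogonal_transformation g" "\<And>x. f x = f 0 + r *\<^sub>R g x"
proof (rule that)
  let ?g = "\<lambda>x. (1 / r) *\<^sub>R (f x - f 0)"
  have r: "r > 0" and d: "dist (f x) (f y) = r * dist x y" for x y
    using assms by (auto simp: similarity_def)
  show "orthogonal_transformation ?g"
    unfolding orthogonal_transformation_isometry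
  proof safe
    fix x y
    have "?g x - ?g y = (1 / r) *\<^sub>R (f x - f y)"
      by (simp add: algebra_simps)
    then show "dist (?g x) (?g y) = dist x y"
      using r d[of x y] by (simp add: dist_norm)
  qed simp
  show "f x = f 0 + r *\<^sub>R ?g x" for x
    using r by simp
qed

lemma similarity_compose:
  "similarity r f \<Longrightarrow> similarity s g \<Longrightarrow> similarity (r * s) (f \<circ> g)"
  by (simp add: similarity_def)

lemma similarity_inverse:
  assumes "similarity r f"
  obtains g where "similarity (1 / r) g" "\<And>x. f (g x) = x" "\<And>x. g (f x) = x"
proof -
  obtain h where h: "orthogonal_transformation h" "\<And>x. f x = f 0 + r *\<^sub>R h x"
    using similarity_affine[OF assms] by blast
  have r: "r > 0" and d: "dist (f x) (f y) = r * dist x y" for x y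
    using assms by (auto simp: similarity_def)
  have "\<exists>x. f x = y" for y
  proof -
    obtain x where "h x = (1 / r) *\<^sub>R (y - f 0)"
      using orthogonal_transformation_surj[OF h(1)] by (metis surjD)
    then show ?thesis
      using h(2)[of x] r by (intro exI[of _ x]) simp
  qed
  then obtain g where g: "f (g y) = y" for y
    by metis
  have "g (f x) = x" for x
    using d[of "g (f x)" x] g[of "f x"] r by simp
  moreover have "dist (g x) (g y) = (1 / r) * dist x y" for x y
    using r d[of "g x" "g y"] by (simp add: g)
  ultimately show ?thesis
    using that[of g] g r by (simp add: similarity_def)
qed

lemma region_map_tile:
  assumes "similarity r f"
  shows "region (map_tile f t) = f ` region t"
proof (cases t)
  case (fields A C B)
  obtain g where g: "orthogonal_transformation g" "\<And>x. f x = f 0 + r *\<^sub>R g x"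
    using similarity_affine[OF assms] by blast
  have lin: "linear (\<lambda>x. r *\<^sub>R g x)"
    using g(1) by (simp add: orthogonal_transformation_def linear_compose_scale_right)
  have *: "f ` S = (\<lambda>y. f 0 + y) ` (\<lambda>x. r *\<^sub>R g x) ` S" for S
    unfolding image_image by (rule image_cong) (auto simp flip: g(2))
  have "f ` (convex hull {A, C, B}) = convex hull (f ` {A, C, B})"
    unfolding * by (simp only: convex_hull_linear_image[OF lin] convex_hull_translation)
  then show ?thesis
    by (simp add: fields)
qed

lemma hypotenuse_map_tile:
  "similarity r f \<Longrightarrow> hypotenuse (map_tile f t) = r * hypotenuse t"
  by (cases t) (simp add: similarity_def)

lemma map_tile_compose: "map_tile (f \<circ> g) t = map_tile f (map_tile g t)"
  by (cases t) simp

text \<open>All points of the construction are affine combinations of the vertices. The only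
  coefficient that depends on the tile is the position of the foot, a quotient of inner products in
  which the factor \<open>r\<^sup>2\<close> cancels. A positive hypotenuse gives
  \<open>A \<noteq> B\<close>, so that the foot is well defined.\<close>

lemma daughters_map_tile:
  assumes f: "similarity r f" and t: "hypotenuse t > 0"
  shows "daughters (map_tile f t) = map_tile f ` daughters t"
proof (cases t)
  case (fields A C B)
  obtain g where g: "orthogonal_transformation g" "\<And>x. f x = f 0 + r *\<^sub>R g x"
    using similarity_affine[OF f] by blast
  have lin: "linear g" and r: "r > 0"
    using g(1) f by (auto simp: orthogonal_transformation_def similarity_def)
  have inner: "g x \<bullet> g y = x \<bullet> y" for x y
    using g(1) by (simp add: orthogonal_transformation_def)
  have AB: "A \<noteq> B" "f A \<noteq> f B"
    using t hypotenuse_map_tile[OF f, of t] r by (auto simp: fields)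
  have diff: "f x - f y = r *\<^sub>R g (x - y)" for x y
    unfolding g(2)[of x] g(2)[of y] by (simp add: linear_diff[OF lin] algebra_simps)
  have affine: "f (x + k *\<^sub>R (y - x)) = f x + k *\<^sub>R (f y - f x)" for x y k
  proof -
    have "f (x + k *\<^sub>R (y - x)) - f x = k *\<^sub>R (f y - f x)"
      unfolding diff by (simp only: add_diff_cancel_left' linear_scale[OF lin] scaleR_left_commute)
    then show ?thesis
      by (metis add.commute diff_add_cancel)
  qed
  have mid: "midpoint (f x) (f y) = f (midpoint x y)" for x y
  proof -
    have "midpoint u v = u + (1 / 2) *\<^sub>R (v - u)" for u v :: point
      by (simp add: midpoint_def vec_eq_iff field_simps)
    then show ?thesis
      by (simp only: affine)
  qed
  define k where "k = (C - A) \<bullet> (B - A) / ((B - A) \<bullet> (B - A))"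
  have "(f C - f A) \<bullet> (f B - f A) / ((f B - f A) \<bullet> (f B - f A)) = k"
    unfolding diff k_def using r by (simp add: inner)
  then have "foot (f C) (f A) (f B) = f (foot C A B)"
    by (simp only: foot_eq[OF AB(1)] foot_eq[OF AB(2)] affine k_def)
  then show ?thesis
    by (simp add: fields Let_def mid)
qed

text \<open>Polarization: inner products of differences are combinations of squared
  distances.\<close>

lemma similarity_inner:
  assumes "similarity r f"
  shows "(f x - f z) \<bullet> (f y - f z) = r\<^sup>2 * ((x - z) \<bullet> (y - z))"
proof -
  have d: "norm (f u - f v) = r * norm (u - v)" for u v
    using assms by (simp add: similarity_def dist_norm)
  show ?thesis
    unfolding dot_norm_neg diff_diff_eq2 diff_add_cancel add_diff_cancel_left' d power_mult_distrib
    by (simp add: d power_mult_distrib algebra_simps)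
qed

text \<open>The threshold must scale along with the tile. With \<open>s \<ge> 0\<close> every tile
  that is split has positive hypotenuse, as \<open>daughters_map_tile\<close> requires.\<close>

lemma leaf_map_tile:
  assumes "leaf s t u" "similarity r f" "s \<ge> 0"
  shows "leaf (r * s) (map_tile f t) (map_tile f u)"
  using assms
proof (induction rule: leaf.induct)
  case (stop t)
  then show ?case
    using hypotenuse_map_tile[of r f t] by (intro leaf.stop) (simp add: similarity_def)
next
  case (split t d u)
  have "r > 0"
    using split.prems by (simp add: similarity_def)
  moreover have "map_tile f d \<in> daughters (map_tile f t)"
    using split by (subst daughters_map_tile) auto
  moreover have "hypotenuse (map_tile f t) > r * s"
    using split(1) \<open>r > 0\<close> by (simp add: hypotenuse_map_tile[OF split.prems(1)])
  ultimately show ?case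
    using split by (blast intro: leaf.split)
qed

text \<open>The converse inclusion applies \<open>leaf_map_tile\<close> to the inverse
  similarity.\<close>

lemma leaves_map_tile:
  assumes f: "similarity r f" and "s \<ge> 0"
  shows "{u. leaf (r * s) (map_tile f t) u} = map_tile f ` {u. leaf s t u}"
proof -
  obtain g where g: "similarity (1 / r) g" "\<And>x. f (g x) = x" "\<And>x. g (f x) = x"
    using similarity_inverse[OF f] by blast
  have r: "r > 0"
    using f by (simp add: similarity_def)
  have gf: "map_tile g (map_tile f v) = v" and fg: "map_tile f (map_tile g v) = v" for v
    by (cases v, simp add: g)+
  have "leaf s t (map_tile g u)" if "leaf (r * s) (map_tile f t) u" for u
    using leaf_map_tile[OF that g(1)] r assms(2) by (simp add: gf)
  then have "u \<in> map_tile f ` {u. leaf s t u}" if "leaf (r * s) (map_tile f t) u" for u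
    using that fg by (metis image_eqI mem_Collect_eq)
  then show ?thesis
    using leaf_map_tile[OF _ f assms(2)] by blast
qed

section \<open>Metric shape of the tiles\<close>

locale right_triangle =
  fixes a b c :: real
  assumes a: "a > 0" and b: "b > 0" and c: "c > 0" and pythagoras: "a\<^sup>2 + b\<^sup>2 = c\<^sup>2"
begin

lemma b_less_c: "b < c" and a_less_c: "a < c"
proof -
  have "b\<^sup>2 < c\<^sup>2" "a\<^sup>2 < c\<^sup>2"
    using a b pythagoras by (auto simp flip: pythagoras)
  then show "b < c" "a < c"
    using c by (auto intro: power_less_imp_less_base)
qed

text \<open>An angle-free version of \<open>is_tile\<close> that carries the scale \<open>k\<close>
  relative to the basic tile. Perpendicular legs of the right lengths already determine the
  hypotenuse and the angles.\<close>

fun right_tile :: "real \<Rightarrow> tile \<Rightarrow> bool" where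
  "right_tile k (A, C, B) \<longleftrightarrow>
     k > 0 \<and> (A - C) \<bullet> (B - C) = 0 \<and> norm (A - C) = k * b \<and> norm (B - C) = k * a"

lemma hypotenuse_right_tile:
  assumes "right_tile k t"
  shows "hypotenuse t = k * c"
proof (cases t)
  case (fields A C B)
  have "(dist A B)\<^sup>2 = (norm ((A - C) - (B - C)))\<^sup>2"
    by (simp add: dist_norm)
  also have "\<dots> = (norm (A - C))\<^sup>2 + (norm (B - C))\<^sup>2"
    using assms unfolding fields power2_norm_eq_inner
    by (simp add: inner_diff_left inner_diff_right inner_commute)
  also have "\<dots> = (k * c)\<^sup>2"
    using assms by (simp add: fields power_mult_distrib flip: pythagoras distrib_left)
  finally show ?thesis
    using assms c by (simp add: fields)
qed

lemma basic_tile_right: "right_tile 1 (basic_tile a b)"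
  using a b by (simp add: basic_tile_def inner_vec_def norm_vec_def L2_set_def sum_2)

text \<open>As \<open>CB\<close> is perpendicular to \<open>AC\<close>, the cosine at
  \<open>A\<close> is \<open>b / c\<close>, and Pythagoras turns its \<open>arccos\<close> into
  \<open>arcsin (a / c)\<close>.\<close>

lemma is_tile_right:
  assumes "right_tile k t"
  shows "is_tile a b c t"
proof (cases t)
  case (fields A C B)
  have k: "k > 0" and orth: "(A - C) \<bullet> (B - C) = 0"
    and AC: "norm (A - C) = k * b" and BC: "norm (B - C) = k * a"
    using assms by (auto simp: fields)
  have AB: "dist A B = k * c"
    using hypotenuse_right_tile[OF assms] by (simp add: fields)
  have "(C - A) \<bullet> (B - A) = (A - C) \<bullet> (A - C) - (A - C) \<bullet> (B - C)"
    by (simp add: inner_diff_left inner_diff_right inner_commute)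
  then have "(C - A) \<bullet> (B - A) = (k * b)\<^sup>2"
    using orth AC by (simp flip: power2_norm_eq_inner)
  then have "angle_at A C B = arccos (b / c)"
    using k AB AC b unfolding angle_at_def
    by (simp add: dist_norm norm_minus_commute power2_eq_square)
  also have "b / c = sqrt (1 - (a / c)\<^sup>2)"
    using a b c pythagoras by (intro real_sqrt_unique[symmetric]) (auto simp: field_simps)
  also have "arccos (sqrt (1 - (a / c)\<^sup>2)) = arcsin (a / c)"
    using a c a_less_c by (intro arcsin_arccos_sqrt_pos[symmetric]) auto
  finally have "angle_at A C B = arcsin (a / c)" .
  moreover have "angle_at C A B = pi / 2"
    using orth by (simp add: angle_at_def)
  ultimately show ?thesis
    using k AB AC BC by (auto simp: fields dist_norm norm_minus_commute)
qed

lemma area_right_tile: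
  assumes "right_tile k t"
  shows "measure lborel (region t) = k\<^sup>2 * (a * b / 2)"
proof (cases t)
  case (fields A C B)
  define x y u v where "x = A $ 1 - C $ 1" and "y = A $ 2 - C $ 2"
    and "u = B $ 1 - C $ 1" and "v = B $ 2 - C $ 2"
  have k: "k > 0" and orth: "x * u + y * v = 0"
    and AC: "x\<^sup>2 + y\<^sup>2 = (k * b)\<^sup>2" and BC: "u\<^sup>2 + v\<^sup>2 = (k * a)\<^sup>2"
  proof -
    have "x\<^sup>2 + y\<^sup>2 = (norm (A - C))\<^sup>2" "u\<^sup>2 + v\<^sup>2 = (norm (B - C))\<^sup>2"
      "x * u + y * v = (A - C) \<bullet> (B - C)"
      unfolding power2_norm_eq_inner x_def y_def u_def v_def
      by (simp_all add: inner_vec_def sum_2 power2_eq_square)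
    then show "k > 0" "x * u + y * v = 0" "x\<^sup>2 + y\<^sup>2 = (k * b)\<^sup>2" "u\<^sup>2 + v\<^sup>2 = (k * a)\<^sup>2"
      using assms by (simp_all add: fields)
  qed
  \<comment> \<open>Lagrange's identity: for perpendicular legs the determinant is, up to sign, the
    product of their lengths.\<close>
  have "(u * y - x * v)\<^sup>2 = (x\<^sup>2 + y\<^sup>2) * (u\<^sup>2 + v\<^sup>2) - (x * u + y * v)\<^sup>2"
    by (simp add: power2_eq_square algebra_simps)
  also have "\<dots> = (k\<^sup>2 * (a * b))\<^sup>2"
    unfolding orth AC BC by (simp add: power2_eq_square algebra_simps)
  finally have "\<bar>u * y - x * v\<bar> = k\<^sup>2 * (a * b)"
    using a b unfolding power2_eq_iff by auto
  moreover have "measure lborel (region t) = \<bar>u * y - x * v\<bar> / 2"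
    unfolding fields region.simps insert_commute[of A C] content_triangle x_def y_def u_def v_def
    by (simp add: abs_minus_commute algebra_simps)
  ultimately show ?thesis
    by simp
qed

lemma right_tile_map_tile:
  assumes "right_tile k t" "similarity r f"
  shows "right_tile (r * k) (map_tile f t)"
proof (cases t)
  case (fields A C B)
  have "norm (f x - f y) = r * norm (x - y)" for x y
    using assms(2) by (simp add: similarity_def dist_norm)
  then show ?thesis
    using assms by (auto simp: fields similarity_inner[OF assms(2)] similarity_def)
qed

text \<open>The legs of the basic tile lie on the coordinate axes. Sending the axes to the legs of
  \<open>t\<close>, after dividing the coordinates by the leg lengths \<open>b\<close> and
  \<open>a\<close>, scales all distances by \<open>k\<close> because the legs are perpendicular.
  Claims about the basic tile thereby transfer to every tile.\<close>

lemma right_tile_similar: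
  assumes "right_tile k t"
  obtains f where "similarity k f" "map_tile f (basic_tile a b) = t"
proof (cases t)
  case (fields A C B)
  define f where "f x = C + (x $ 1 / b) *\<^sub>R (A - C) + (x $ 2 / a) *\<^sub>R (B - C)" for x :: point
  have k: "k > 0" and orth: "(A - C) \<bullet> (B - C) = 0"
    and AC: "norm (A - C) = k * b" and BC: "norm (B - C) = k * a"
    using assms by (auto simp: fields)
  have "dist (f x) (f y) = k * dist x y" for x y
  proof -
    define z where "z = x - y"
    have "f x - f y = (z $ 1 / b) *\<^sub>R (A - C) + (z $ 2 / a) *\<^sub>R (B - C)"
      by (simp add: f_def z_def diff_divide_distrib scaleR_diff_left)
    then have "(norm (f x - f y))\<^sup>2 =
        (norm ((z $ 1 / b) *\<^sub>R (A - C)))\<^sup>2 + (norm ((z $ 2 / a) *\<^sub>R (B - C)))\<^sup>2"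
      by (simp only: norm_add_Pythagorean orthogonal_def inner_scaleR_left inner_scaleR_right orth mult_zero_right)
    also have "\<dots> = k\<^sup>2 * ((z $ 1)\<^sup>2 + (z $ 2)\<^sup>2)"
      unfolding norm_scaleR AC BC power_mult_distrib power2_abs power_divide
      using a b by (simp add: distrib_left)
    also have "\<dots> = (k * norm z)\<^sup>2"
      unfolding power_mult_distrib power2_norm_eq_inner
      by (simp add: inner_vec_def sum_2 power2_eq_square)
    finally show ?thesis
      using k by (simp add: dist_norm z_def)
  qed
  then have "similarity k f"
    using k by (simp add: similarity_def)
  moreover have "map_tile f (basic_tile a b) = t"
    using a b by (simp add: basic_tile_def fields f_def)
  ultimately show ?thesis
    using that by blast
qed

section \<open>Geometry of the five daughters\<close>

lemma foot_right_tile: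
  assumes "right_tile k (A, C, B)"
  shows "foot C A B = A + (b\<^sup>2 / c\<^sup>2) *\<^sub>R (B - A)"
proof -
  have k: "k > 0" and orth: "(A - C) \<bullet> (B - C) = 0"
    and AC: "norm (A - C) = k * b"
    using assms by auto
  have AB: "norm (B - A) = k * c"
    using hypotenuse_right_tile[OF assms] by (simp add: dist_norm norm_minus_commute)
  then have "A \<noteq> B"
    using k c by auto
  have "(C - A) \<bullet> (B - A) = (A - C) \<bullet> (A - C) - (A - C) \<bullet> (B - C)"
    by (simp add: inner_diff_left inner_diff_right inner_commute)
  then have "(C - A) \<bullet> (B - A) = (k * b)\<^sup>2" "(B - A) \<bullet> (B - A) = (k * c)\<^sup>2"
    using orth AC AB by (simp_all flip: power2_norm_eq_inner)
  then show ?thesis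
    using k by (simp add: foot_eq[OF \<open>A \<noteq> B\<close>] power_mult_distrib)
qed

text \<open>Each leg of each daughter is a multiple of \<open>A - B\<close> or of the altitude
  \<open>F - C\<close>, one of each kind per daughter. These two vectors are perpendicular, so only
  lengths remain to be compared.\<close>

lemma right_tile_daughter:
  assumes t: "right_tile k t" and d: "d \<in> daughters t"
  shows "right_tile (k * (b / (2 * c))) d \<or> right_tile (k * (a / c)) d"
proof (cases t)
  case (fields A C B)
  define F where "F = foot C A B"
  have k: "k > 0" and orth: "(A - C) \<bullet> (B - C) = 0"
    and AC: "norm (A - C) = k * b" and BC: "norm (B - C) = k * a"
    using t by (auto simp: fields)
  have AB: "norm (A - B) = k * c"
    using hypotenuse_right_tile[OF t] by (simp add: fields dist_norm)
  \<comment> \<open>\<open>y\<close> is the ratio of \<open>AF\<close> to \<open>AB\<close>.\<close>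
  define y where "y = b\<^sup>2 / c\<^sup>2"
  have y: "1 - y = a\<^sup>2 / c\<^sup>2" "0 < y" "0 < 1 - y"
    using a b c pythagoras b_less_c
    by (auto simp: y_def field_simps intro: power_strict_mono)
  have F: "F = A + y *\<^sub>R (B - A)"
    using foot_right_tile t by (simp add: fields F_def y_def)
  then have FC: "F - C = (1 - y) *\<^sub>R (A - C) + y *\<^sub>R (B - C)"
    by (simp add: algebra_simps)
  have "(F - C) \<bullet> (A - B) = (F - C) \<bullet> ((A - C) - (B - C))"
    by simp
  also have "\<dots> = (1 - y) * (norm (A - C))\<^sup>2 - y * (norm (B - C))\<^sup>2"
    unfolding FC power2_norm_eq_inner inner_add_left inner_scaleR_left
      inner_diff_right[of _ "A - C" "B - C"] inner_commute[of "B - C" "A - C"] orth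
    by (simp only: mult_zero_right diff_0 diff_zero mult_minus_right)
  also have "\<dots> = 0"
    unfolding AC BC y(1) by (simp add: y_def power_mult_distrib)
  finally have perp: "(F - C) \<bullet> (A - B) = 0" .
  have "(norm (F - C))\<^sup>2 = (norm ((1 - y) *\<^sub>R (A - C)))\<^sup>2 + (norm (y *\<^sub>R (B - C)))\<^sup>2"
    unfolding FC
    by (simp only: norm_add_Pythagorean orthogonal_def inner_scaleR_left inner_scaleR_right orth mult_zero_right)
  also have "\<dots> = k\<^sup>2 * a\<^sup>2 * b\<^sup>2 * (a\<^sup>2 + b\<^sup>2) / (c\<^sup>2)\<^sup>2"
    unfolding norm_scaleR AC BC y(1) power_mult_distrib power2_abs
    unfolding y_def by (simp add: power_divide power2_eq_square algebra_simps add_divide_distrib)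
  also have "\<dots> = (k * a * b / c)\<^sup>2"
    unfolding pythagoras using c by (simp add: field_simps power2_eq_square)
  finally have CF: "norm (F - C) = k * a * b / c"
    using k a b c by simp
  have AN: "A - midpoint A F = (y / 2) *\<^sub>R (A - B)"
    and MK: "midpoint A C - midpoint F C = (y / 2) *\<^sub>R (A - B)"
    and FN: "F - midpoint A F = (- y / 2) *\<^sub>R (A - B)"
    and BF: "B - F = (y - 1) *\<^sub>R (A - B)"
    by (simp_all add: F midpoint_def vec_eq_iff field_simps)
  have MN: "midpoint A C - midpoint A F = (- 1 / 2) *\<^sub>R (F - C)"
    and CK: "C - midpoint F C = (- 1 / 2) *\<^sub>R (F - C)"
    and FK: "F - midpoint F C = (1 / 2) *\<^sub>R (F - C)"
    and CF': "C - F = (- 1) *\<^sub>R (F - C)"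
    by (simp_all add: midpoint_def vec_eq_iff field_simps)
  \<comment> \<open>The four small daughters differ only in the signs of these coefficients: the
    long leg is half of \<open>AF\<close> and the short leg half of the altitude.\<close>
  have small: "right_tile (k * (b / (2 * c))) (P, Q, R)"
    if "P - Q = l *\<^sub>R (A - B)" "\<bar>l\<bar> = y / 2" "R - Q = m *\<^sub>R (F - C)" "\<bar>m\<bar> = 1 / 2" for P Q R l m
  proof -
    have "norm (P - Q) = k * (b / (2 * c)) * b" "norm (R - Q) = k * (b / (2 * c)) * a"
      unfolding that(1,3) norm_scaleR that(2,4) AB CF using c
      by (simp_all add: y_def power2_eq_square field_simps)
    moreover have "(P - Q) \<bullet> (R - Q) = 0"
      unfolding that(1,3) using perp
      by (simp only: inner_scaleR_left inner_scaleR_right inner_commute[of "A - B"] mult_zero_right)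
    ultimately show ?thesis
      using k b c by simp
  qed
  have large: "right_tile (k * (a / c)) (C, F, B)"
  proof -
    have "norm (B - F) = k * (a / c) * a"
      unfolding BF norm_scaleR AB abs_minus_commute[of y] using y
      by (simp add: power2_eq_square)
    moreover have "norm (C - F) = k * (a / c) * b"
      using CF by (simp add: norm_minus_commute)
    moreover have "(C - F) \<bullet> (B - F) = 0"
      unfolding CF' BF using perp by (simp only: inner_scaleR_left inner_scaleR_right mult_zero_right)
    ultimately show ?thesis
      using k a c by simp
  qed
  have yy: "\<bar>y / 2\<bar> = y / 2" "\<bar>- y / 2\<bar> = y / 2" "\<bar>- 1 / 2 :: real\<bar> = 1 / 2" "\<bar>1 / 2 :: real\<bar> = 1 / 2"
    using y by auto
  show ?thesis
    using d small[OF AN yy(1) MN yy(3)] small[OF MK yy(1) CK yy(3)] small[OF MK yy(1) FK yy(4)]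
      small[OF FN yy(2) MN yy(3)] large
    by (auto simp add: fields Let_def simp flip: F_def simp del: right_tile.simps)
qed

text \<open>Four cuts produce the daughters: \<open>CF\<close> splits the tile, \<open>FM\<close>
  splits \<open>CAF\<close>, and then \<open>MN\<close> and \<open>MK\<close> split the two halves.
  Any two daughters lie on opposite sides of one of these cuts.\<close>

lemma
  assumes "right_tile k t"
  shows region_eq_daughters: "region t = (\<Union>d\<in>daughters t. region d)"
    and daughters_disjoint:
      "pairwise (\<lambda>d e. interior (region d) \<inter> interior (region e) = {}) (daughters t)"
proof -
  obtain A C B where t: "t = (A, C, B)"
    by (cases t)
  define F M N K where "F = foot C A B" and "M = midpoint A C" and "N = midpoint A F"
    and "K = midpoint F C"
  have F: "F = A + (b\<^sup>2 / c\<^sup>2) *\<^sub>R (B - A)"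
    using foot_right_tile assms by (simp add: t F_def)
  have v: "0 < b\<^sup>2 / c\<^sup>2" "b\<^sup>2 / c\<^sup>2 < 1"
    using b c b_less_c by (auto intro: power_strict_mono)
  have mid: "midpoint x y = x + (1 / 2) *\<^sub>R (y - x)" for x y :: point
    by (simp add: midpoint_def vec_eq_iff field_simps)
  have half: "0 < (1 / 2 :: real)" "(1 / 2 :: real) < 1"
    by auto
  note cut1 = triangle_cut[OF v F, of C]
  note cut2 = triangle_cut[OF half M_def[unfolded mid], of F]
  note cut3 = triangle_cut[OF half N_def[unfolded mid], of M]
  note cut4 = triangle_cut[OF half K_def[unfolded mid], of M]
  define H where "H x y z = convex hull {x, y, z}" for x y z :: point
  have H: "H x y z = H y x z" "H x y z = H x z y" for x y z
    by (simp_all add: H_def insert_commute)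
  have cuts: "H A C B = H C A F \<union> H C F B" "H C A F = H A M F \<union> H F M C"
      "H A M F = H A N M \<union> H F N M" "H F M C = H M K F \<union> H M K C"
    and dis: "interior (H C A F) \<inter> interior (H C F B) = {}"
      "interior (H A M F) \<inter> interior (H F M C) = {}"
      "interior (H A N M) \<inter> interior (H F N M) = {}"
      "interior (H M K F) \<inter> interior (H M K C) = {}"
    using cut1 cut2 cut3 cut4 unfolding H_def[symmetric] by (metis H)+
  have d: "daughters t = {(A, N, M), (M, K, C), (M, K, F), (F, N, M), (C, F, B)}"
    by (simp add: t Let_def F_def M_def N_def K_def)
  show "region t = (\<Union>d\<in>daughters t. region d)"
    unfolding d by (simp add: t cuts flip: H_def) blast
  have mono: "interior X' \<inter> interior Y' = {}"
    if "interior X \<inter> interior Y = {}" "X' \<subseteq> X" "Y' \<subseteq> Y" for X Y X' Y' :: "point set"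
    using that interior_mono by blast
  have dis': "interior (H A N M) \<inter> interior (H M K C) = {}"
    "interior (H A N M) \<inter> interior (H M K F) = {}"
    "interior (H F N M) \<inter> interior (H M K C) = {}"
    "interior (H F N M) \<inter> interior (H M K F) = {}"
    using mono[OF dis(2)] by (simp_all add: cuts)
  have sub: "H A N M \<subseteq> H C A F" "H F N M \<subseteq> H C A F" "H M K C \<subseteq> H C A F" "H M K F \<subseteq> H C A F"
    unfolding cuts by blast+
  have dis'': "interior (H A N M) \<inter> interior (H C F B) = {}"
    "interior (H F N M) \<inter> interior (H C F B) = {}"
    "interior (H M K C) \<inter> interior (H C F B) = {}"
    "interior (H M K F) \<inter> interior (H C F B) = {}"
    using mono[OF dis(1)] sub by blast+
  show "pairwise (\<lambda>d e. interior (region d) \<inter> interior (region e) = {}) (daughters t)"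
    unfolding d using dis(3,4) dis' dis''
    by (auto simp add: pairwise_insert Int_commute simp flip: H_def)
qed

section \<open>Sizes, disjointness and covering for threshold subdivisions\<close>

definition tile :: "tile \<Rightarrow> bool" where
  "tile t \<longleftrightarrow> (\<exists>k. right_tile k t)"

lemma hypotenuse_pos: "tile t \<Longrightarrow> hypotenuse t > 0"
  using c hypotenuse_right_tile by (force simp: tile_def elim: right_tile.elims)

lemma right_tile_hypotenuse: "tile t \<Longrightarrow> right_tile (hypotenuse t / c) t"
  using c hypotenuse_right_tile unfolding tile_def by fastforce

lemma tile_basic: "tile (basic_tile a b)"
  using basic_tile_right tile_def by blast

lemma hypotenuse_basic: "hypotenuse (basic_tile a b) = c"
  using hypotenuse_right_tile[OF basic_tile_right] by simp

lemma tile_map_tile: "tile t \<Longrightarrow> similarity r f \<Longrightarrow> tile (map_tile f t)"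
  using right_tile_map_tile tile_def by blast

definition ratios :: "real set" where
  "ratios = {b / (2 * c), a / c}"

lemma ratios_bounds: "r \<in> ratios \<Longrightarrow> 0 < r \<and> r < 1"
  using a b c a_less_c b_less_c by (auto simp: ratios_def)

lemma tile_daughter:
  assumes "tile t" "d \<in> daughters t"
  shows "tile d" and "\<exists>r\<in>ratios. hypotenuse d = r * hypotenuse t"
proof -
  obtain k where k: "right_tile k t"
    using assms by (auto simp: tile_def)
  have "\<exists>r\<in>ratios. right_tile (k * r) d"
    using right_tile_daughter[OF k assms(2)] unfolding ratios_def by blast
  then show "tile d" "\<exists>r\<in>ratios. hypotenuse d = r * hypotenuse t"
    using hypotenuse_right_tile[OF k] hypotenuse_right_tile[of _ d] by (auto simp: tile_def mult_ac)
qed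

lemma hypotenuse_daughter_less:
  assumes "tile t" "d \<in> daughters t"
  shows "hypotenuse d < hypotenuse t"
  using tile_daughter(2)[OF assms] hypotenuse_pos[OF assms(1)] ratios_bounds by fastforce

lemma leaf_tile: "leaf s t u \<Longrightarrow> tile t \<Longrightarrow> tile u"
  by (induction rule: leaf.induct) (auto intro: tile_daughter)

lemma leaf_hypotenuse_le: "leaf s t u \<Longrightarrow> tile t \<Longrightarrow> hypotenuse u \<le> hypotenuse t"
  by (induction rule: leaf.induct)
    (auto dest: tile_daughter hypotenuse_daughter_less intro: order_trans less_imp_le)

text \<open>A leaf other than \<open>t\<close> itself has a parent that was split, hence was larger
  than \<open>s\<close>, and one split shrinks a tile at most by the factor
  \<open>Min ratios\<close>.\<close>

lemma leaf_hypotenuse_lower: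
  "leaf s t u \<Longrightarrow> tile t \<Longrightarrow> u \<noteq> t \<Longrightarrow> Min ratios * s < hypotenuse u"
proof (induction rule: leaf.induct)
  case (split t d u)
  obtain r where r: "r \<in> ratios" "hypotenuse d = r * hypotenuse t"
    using tile_daughter(2) split by blast
  have min: "Min ratios \<le> r" "0 < Min ratios"
    using r ratios_bounds by (auto simp: ratios_def)
  have "Min ratios * s < Min ratios * hypotenuse t"
    using split min by simp
  also have "\<dots> \<le> hypotenuse d"
    using min r hypotenuse_pos[of t] split.prems by (simp add: mult_right_mono)
  finally show ?case
    using split tile_daughter(1) by (cases "u = d") auto
qed simp

lemma leaf_region: "leaf s t u \<Longrightarrow> tile t \<Longrightarrow> region u \<subseteq> region t"
proof (induction rule: leaf.induct)
  case (split t d u)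
  then show ?case
    using tile_daughter(1) region_eq_daughters unfolding tile_def by blast
qed simp

text \<open>The descents to two different leaves agree until they enter different daughters of one
  tile, and those daughters have disjoint interiors.\<close>

lemma leaves_disjoint:
  "leaf s t u \<Longrightarrow> tile t \<Longrightarrow> leaf s t v \<Longrightarrow> u \<noteq> v \<Longrightarrow> interior (region u) \<inter> interior (region v) = {}"
proof (induction rule: leaf.induct)
  case (stop t)
  then show ?case
    by (simp add: leaf_of_small)
next
  case (split t d u)
  then obtain e where e: "e \<in> daughters t" "leaf s e v"
    by (auto simp: leaf_of_large)
  show ?case
  proof (cases "d = e")
    case True
    then show ?thesis
      using split e tile_daughter(1) by blast
  next
    case False
    then have "interior (region d) \<inter> interior (region e) = {}"
      using split.prems(1) split.hyps(2) e(1) daughters_disjoint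
      unfolding tile_def pairwise_def by blast
    moreover have "region u \<subseteq> region d" "region v \<subseteq> region e"
      using split e leaf_region tile_daughter(1) by blast+
    ultimately show ?thesis
      using interior_mono by blast
  qed
qed

text \<open>Descend into a daughter that contains \<open>x\<close>. The descent ends because the
  hypotenuse shrinks at each level at least by the factor \<open>Max ratios < 1\<close>.\<close>

lemma leaves_cover:
  assumes "tile t" "x \<in> region t" "s > 0"
  shows "\<exists>u. leaf s t u \<and> x \<in> region u"
proof -
  have max: "r \<le> Max ratios" if "r \<in> ratios" for r
    using that by (auto simp: ratios_def)
  have max_bounds: "0 < Max ratios" "Max ratios < 1"
    using a b c ratios_bounds by (auto simp: ratios_def max_def)
  \<comment> \<open>Here \<open>n\<close> bounds the number of levels still to descend.\<close>
  have *: "\<exists>u. leaf s t u \<and> x \<in> region u"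
    if "Max ratios ^ n * hypotenuse t \<le> s" "tile t" "x \<in> region t" for n t
    using that
  proof (induction n arbitrary: t)
    case 0
    then show ?case
      using leaf.stop[of t s] by (intro exI[of _ t]) simp
  next
    case (Suc n)
    show ?case
    proof (cases "hypotenuse t \<le> s")
      case True
      then show ?thesis
        using Suc.prems by (blast intro: leaf.stop)
    next
      case False
      obtain d where d: "d \<in> daughters t" "x \<in> region d"
        using Suc.prems(2,3) region_eq_daughters unfolding tile_def by blast
      obtain r where r: "r \<in> ratios" "hypotenuse d = r * hypotenuse t"
        using tile_daughter(2) Suc.prems(2) d(1) by blast
      have "Max ratios ^ n * hypotenuse d \<le> Max ratios ^ n * (Max ratios * hypotenuse t)"
        unfolding r(2) using max[OF r(1)] max_bounds hypotenuse_pos[OF Suc.prems(2)]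
        by (intro mult_left_mono mult_right_mono) auto
      also have "\<dots> \<le> s"
        using Suc.prems(1) by (simp add: mult_ac)
      finally obtain u where "leaf s d u" "x \<in> region u"
        using Suc.IH tile_daughter(1) Suc.prems(2) d by blast
      then show ?thesis
        using d(1) False leaf.split[of s t d u] by (intro exI[of _ u]) simp
    qed
  qed
  obtain n where "Max ratios ^ n < s / hypotenuse t"
    using real_arch_pow_inv[of "s / hypotenuse t" "Max ratios"] max_bounds assms(3)
      hypotenuse_pos[OF assms(1)] by auto
  then have "Max ratios ^ n * hypotenuse t \<le> s"
    using hypotenuse_pos[OF assms(1)] by (simp add: field_simps)
  then show ?thesis
    using * assms by blast
qed

text \<open>Distances in a triangle are at most the distance between some two vertices, and the
  hypotenuse is the longest side.\<close>

lemma region_dist_le: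
  assumes "tile t" "x \<in> region t" "y \<in> region t"
  shows "dist x y \<le> hypotenuse t"
proof (cases t)
  case (fields A C B)
  obtain k where k: "right_tile k t"
    using assms by (auto simp: tile_def)
  have *: "k > 0" "dist A C = k * b" "dist B C = k * a" "dist A B = k * c"
    using k hypotenuse_right_tile[OF k] by (auto simp: fields dist_norm)
  then have le: "dist A C \<le> dist A B" "dist B C \<le> dist A B"
    using a_less_c b_less_c by auto
  obtain u v where uv: "u \<in> {A, C, B}" "v \<in> {A, C, B}" "norm (x - y) \<le> norm (u - v)"
    using simplex_extremal_le_exists[of "{A, C, B}" x y] assms(2,3) unfolding fields region.simps
    by blast
  have "dist u v \<le> dist A B"
    using uv(1,2) le by (auto simp: dist_commute)
  then show ?thesis
    using uv(3) by (simp add: fields dist_norm)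
qed

section \<open>The sequence \<open>T_seq\<close> as threshold subdivisions\<close>

definition largest :: "nat \<Rightarrow> real" where
  "largest n = Max (hypotenuse ` T_seq a b n)"

lemma T_seq_finite_nonempty: "finite (T_seq a b n) \<and> T_seq a b n \<noteq> {}"
proof (induction n)
  case (Suc n)
  have "finite (daughters t) \<and> daughters t \<noteq> {}" for t
    by (cases t) (simp add: Let_def)
  then show ?case
    using Suc by (auto simp: subdivide_largest_def)
qed simp

lemma T_seq_Suc:
  "T_seq a b (Suc n) =
    {t \<in> T_seq a b n. hypotenuse t \<noteq> largest n} \<union> (\<Union>t\<in>{t \<in> T_seq a b n. hypotenuse t = largest n}. daughters t)"
  by (auto simp: subdivide_largest_def largest_def split: if_splits)

lemma hypotenuse_le_largest: "t \<in> T_seq a b n \<Longrightarrow> hypotenuse t \<le> largest n"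
  using T_seq_finite_nonempty by (simp add: largest_def)

lemma largest_attained: "\<exists>t\<in>T_seq a b n. hypotenuse t = largest n"
proof -
  have "largest n \<in> hypotenuse ` T_seq a b n"
    unfolding largest_def using T_seq_finite_nonempty by (intro Max_in) auto
  then show ?thesis
    by (metis imageE)
qed

lemma tile_T_seq: "t \<in> T_seq a b n \<Longrightarrow> tile t"
proof (induction n arbitrary: t)
  case 0
  then show ?case
    using tile_basic by simp
next
  case (Suc n)
  then show ?case
    unfolding T_seq_Suc using tile_daughter(1) by blast
qed

text \<open>All tiles of maximal size are split at once, into strictly smaller ones. The sign turns
  the decrease into \<open>strict_mono\<close>, from which injectivity follows.\<close>

lemma largest_decreasing: "strict_mono (\<lambda>n. - largest n)"
proof (rule strict_mono_Suc_iff[THEN iffD2], rule allI)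
  fix n
  have "hypotenuse t < largest n" if t: "t \<in> T_seq a b (Suc n)" for t
  proof -
    consider "t \<in> T_seq a b n" "hypotenuse t \<noteq> largest n"
      | s where "s \<in> T_seq a b n" "hypotenuse s = largest n" "t \<in> daughters s"
      using t unfolding T_seq_Suc by blast
    then show ?thesis
    proof cases
      case 1
      then show ?thesis
        using hypotenuse_le_largest[of t n] by simp
    next
      case (2 s)
      then show ?thesis
        using tile_T_seq hypotenuse_daughter_less by metis
    qed
  qed
  then show "- largest n < - largest (Suc n)"
    using largest_attained[of "Suc n"] by (metis neg_less_iff_less)
qed

lemma hypotenuse_T_seq:
  "t \<in> T_seq a b n \<Longrightarrow> \<exists>i j. hypotenuse t = c * ((b / (2 * c)) ^ i * (a / c) ^ j)"
proof (induction n arbitrary: t)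
  case 0
  then show ?case
    using hypotenuse_basic by (intro exI[of _ 0]) simp
next
  case (Suc n)
  show ?case
  proof (cases "t \<in> T_seq a b n")
    case False
    then obtain s where s: "s \<in> T_seq a b n" "t \<in> daughters s"
      using Suc.prems unfolding T_seq_Suc by blast
    obtain i j where "hypotenuse s = c * ((b / (2 * c)) ^ i * (a / c) ^ j)"
      using Suc.IH[OF s(1)] by blast
    then have "hypotenuse t = c * ((b / (2 * c)) ^ Suc i * (a / c) ^ j) \<or>
        hypotenuse t = c * ((b / (2 * c)) ^ i * (a / c) ^ Suc j)"
      using tile_daughter(2)[OF tile_T_seq[OF s(1)] s(2)] by (auto simp: ratios_def mult_ac)
    then show ?thesis
      by blast
  qed (use Suc.IH in blast)
qed

lemma ex_largest_le:
  assumes "s > 0"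
  shows "\<exists>n. largest n \<le> s"
proof (rule ccontr)
  define p q where "p = b / (2 * c)" and "q = a / c"
  have pq: "0 < p" "p < 1" "0 < q" "q < 1"
    using ratios_bounds by (auto simp: p_def q_def ratios_def)
  \<comment> \<open>Both factors are at most 1, so a value above \<open>s\<close> needs exponents
    below \<open>I\<close> and \<open>J\<close>. If \<open>largest\<close> never dropped to
    \<open>s\<close>, an injective sequence would stay in the finite set \<open>?V\<close>.\<close>
  obtain I J where I: "p ^ I < s / c" and J: "q ^ J < s / c"
    using real_arch_pow_inv[of "s / c"] pq assms c by (metis divide_pos_pos)
  let ?V = "(\<lambda>(i, j). c * (p ^ i * q ^ j)) ` ({..<I} \<times> {..<J})"
  assume "\<not> (\<exists>n. largest n \<le> s)"
  then have large: "largest n > s" for n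
    by (simp add: not_le)
  have "largest n \<in> ?V" for n
  proof -
    obtain i j where ij: "largest n = c * (p ^ i * q ^ j)"
      using largest_attained[of n] hypotenuse_T_seq unfolding p_def q_def by metis
    have gt: "s / c < p ^ i * q ^ j"
      using large[of n] c by (simp add: ij field_simps)
    have "p ^ i * q ^ j \<le> p ^ i" "p ^ i * q ^ j \<le> q ^ j"
      using pq by (auto simp: mult_left_le mult_left_le_one_le power_le_one)
    then have "p ^ I < p ^ i" "q ^ J < q ^ j"
      using I J gt by linarith+
    then have "i < I" "j < J"
      using pq power_decreasing[of I i p] power_decreasing[of J j q] by (auto simp: not_less[symmetric])
    then show ?thesis
      by (auto simp: ij)
  qed
  then have "range largest \<subseteq> ?V"
    by blast
  then have "finite (range largest)"
    by (rule finite_subset) simp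
  moreover have "inj largest"
    using strict_mono_imp_inj_on[OF largest_decreasing] by (auto simp: inj_on_def)
  ultimately show False
    using finite_imageD by blast
qed

text \<open>Take the first \<open>n\<close> at which all hypotenuses are at most \<open>s\<close>.
  Every earlier step splits only tiles larger than \<open>s\<close>, which the threshold subdivision
  splits as well.\<close>

lemma T_seq_eq_leaves:
  assumes "s > 0"
  shows "\<exists>n. T_seq a b n = {u. leaf s (basic_tile a b) u}"
proof -
  define n where "n = (LEAST n. largest n \<le> s)"
  have n: "largest n \<le> s"
    unfolding n_def by (rule LeastI_ex[OF ex_largest_le[OF assms]])
  have less: "s < largest m" if "m < n" for m
    using not_less_Least[OF that[unfolded n_def]] by simp
  \<comment> \<open>Invariant: refining stage \<open>m\<close> down to the threshold gives the
    leaves of the basic tile. At \<open>m = n\<close> nothing is left to refine.\<close>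
  have "(\<exists>t\<in>T_seq a b m. leaf s t u) \<longleftrightarrow> leaf s (basic_tile a b) u" if "m \<le> n" for m u
    using that
  proof (induction m)
    case (Suc m)
    have large: "leaf s t u \<longleftrightarrow> (\<exists>d\<in>daughters t. leaf s d u)" if "hypotenuse t = largest m" for t
      using less[of m] Suc.prems that by (intro leaf_of_large) simp
    have "(\<exists>t\<in>T_seq a b (Suc m). leaf s t u) \<longleftrightarrow> (\<exists>t\<in>T_seq a b m. leaf s t u)"
      unfolding T_seq_Suc using large by blast
    then show ?case
      using Suc by simp
  qed simp
  moreover have "(\<exists>t\<in>T_seq a b n. leaf s t u) \<longleftrightarrow> u \<in> T_seq a b n" for u
  proof -
    have "leaf s t u \<longleftrightarrow> u = t" if "t \<in> T_seq a b n" for t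
      using leaf_of_small[of t s u] hypotenuse_le_largest[OF that] n by simp
    then show ?thesis
      by blast
  qed
  ultimately show ?thesis
    by blast
qed

text \<open>Pull the subdivision back to the basic tile, where the threshold becomes
  \<open>s / r\<close>. The similarity \<open>f\<close> then factors as the rescaling by
  \<open>r\<close> followed by a Euclidean motion.\<close>

lemma supertile_leaves:
  assumes "tile t" "s > 0"
  shows "\<exists>n. supertile a b n {u. leaf s t u}"
proof -
  obtain r where "right_tile r t"
    using assms(1) tile_def by blast
  then obtain f where f: "similarity r f" "map_tile f (basic_tile a b) = t"
    using right_tile_similar by blast
  have r: "r > 0"
    using f(1) by (simp add: similarity_def)
  obtain n where n: "T_seq a b n = {u. leaf (s / r) (basic_tile a b) u}"
    using T_seq_eq_leaves[of "s / r"] r assms(2) by auto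
  have "{u. leaf s t u} = map_tile f ` T_seq a b n"
    using leaves_map_tile[OF f(1), of "s / r" "basic_tile a b"] r assms(2) by (simp add: n f(2))
  moreover have "euclidean_motion (\<lambda>x. f ((1 / r) *\<^sub>R x))"
    using f(1) r by (simp add: euclidean_motion_def similarity_def dist_norm flip: scaleR_diff_right)
  moreover have "(\<lambda>x. f ((1 / r) *\<^sub>R (r *\<^sub>R x))) = f"
    using r by simp
  ultimately have "supertile a b n {u. leaf s t u}"
    unfolding supertile_def using r by (intro exI[of _ "\<lambda>x. f ((1 / r) *\<^sub>R x)"] exI[of _ r]) simp
  then show ?thesis
    by blast
qed

section \<open>Larger tiles with a margin, exhausting the plane\<close>

lemma interior_leaf:
  obtains s u \<epsilon> where "leaf s (basic_tile a b) u" "\<epsilon> > 0"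
    "\<And>x. x \<in> region u \<Longrightarrow> ball x \<epsilon> \<subseteq> region (basic_tile a b)"
proof -
  let ?T = "basic_tile a b"
  \<comment> \<open>A convex set with empty interior is negligible, so positive area yields an inner
    ball.\<close>
  have "measure lborel (region ?T) > 0"
    unfolding area_right_tile[OF basic_tile_right] using a b by simp
  moreover have "convex (region ?T)"
    by (cases ?T) (simp add: convex_convex_hull)
  moreover have "compact (region ?T)"
    by (cases ?T) (simp add: compact_convex_hull finite_imp_compact)
  ultimately have "interior (region ?T) \<noteq> {}"
    using negligible_convex_interior[of "region ?T"] negligible_imp_measure0[of "region ?T"]
    by (auto simp: measure_completion compact_imp_closed)
  then obtain z e where "e > 0" and z: "ball z e \<subseteq> region ?T"
    by (auto simp: mem_interior)
  then have "z \<in> region ?T"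
    by auto
  \<comment> \<open>The leaf at the centre has diameter at most \<open>e / 2\<close>, so the other
    half of the radius is left as margin.\<close>
  then obtain u where u: "leaf (e / 2) ?T u" "z \<in> region u"
    using leaves_cover[OF tile_basic, of z "e / 2"] \<open>e > 0\<close> by auto
  have "ball x (e / 2) \<subseteq> region ?T" if "x \<in> region u" for x
  proof -
    have "dist x z \<le> e / 2"
      using region_dist_le[OF leaf_tile[OF u(1) tile_basic] that u(2)] leaf_small[OF u(1)] by simp
    then have "ball x (e / 2) \<subseteq> ball z e"
      by (intro ball_subset_ball_iff[THEN iffD2]) (auto simp: dist_commute)
    then show ?thesis
      using z by blast
  qed
  then show ?thesis
    using that u(1) \<open>e > 0\<close> by (meson half_gt_zero)
qed

text \<open>The similarity that carries the interior leaf \<open>u\<close> to \<open>t\<close>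
  carries the basic tile to the required \<open>t'\<close>.\<close>

lemma tile_extension:
  obtains \<delta> where "\<delta> > 0"
    "\<And>t. tile t \<Longrightarrow> \<exists>t'. tile t' \<and> leaf (hypotenuse t) t' t \<and>
      (\<forall>x\<in>region t. ball x (\<delta> * hypotenuse t) \<subseteq> region t')"
proof -
  let ?T = "basic_tile a b"
  obtain s u \<epsilon> where u: "leaf s ?T u" and "\<epsilon> > 0"
    and ball: "\<And>x. x \<in> region u \<Longrightarrow> ball x \<epsilon> \<subseteq> region ?T"
    using interior_leaf by blast
  obtain k where "right_tile k u"
    using leaf_tile[OF u tile_basic] tile_def by blast
  then obtain h where h: "similarity k h" "map_tile h ?T = u"
    using right_tile_similar by blast
  obtain g where g: "similarity (1 / k) g" "\<And>x. g (h x) = x"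
    using similarity_inverse[OF h(1)] by metis
  have k: "k > 0"
    using h(1) by (simp add: similarity_def)
  have s: "s > 0"
    using leaf_small[OF u] hypotenuse_pos[OF leaf_tile[OF u tile_basic]] by simp
  \<comment> \<open>The margin \<open>\<epsilon>\<close> is scaled by \<open>l / k\<close>, and
    \<open>l\<close> is \<open>hypotenuse t / c\<close>; this gives the constant
    \<open>\<epsilon> / (k * c)\<close>.\<close>
  have "\<exists>t'. tile t' \<and> leaf (hypotenuse t) t' t \<and>
      (\<forall>x\<in>region t. ball x (\<epsilon> / (k * c) * hypotenuse t) \<subseteq> region t')" if tile_t: "tile t" for t
  proof -
    obtain l where t: "right_tile l t"
      using tile_t tile_def by blast
    then obtain f where f: "similarity l f" "map_tile f ?T = t"
      using right_tile_similar by blast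
    have l: "l > 0"
      using f(1) by (simp add: similarity_def)
    let ?F = "f \<circ> g"
    have F: "similarity (l / k) ?F"
      using similarity_compose[OF f(1) g(1)] by simp
    have "map_tile g u = ?T"
      by (cases ?T) (auto simp flip: h(2) simp: g(2))
    then have Fu: "map_tile ?F u = t"
      by (simp only: map_tile_compose f(2))
    have leaf: "leaf (l / k * s) (map_tile ?F ?T) t"
      using leaf_map_tile[OF u F] s by (simp only: Fu less_imp_le)
    \<comment> \<open>The threshold can be lowered to the size of \<open>t\<close> itself, since
      \<open>t\<close> is still not split there.\<close>
    then have "leaf (hypotenuse t) (map_tile ?F ?T) t"
      using leaf_trans[OF leaf] leaf.stop[of t "hypotenuse t"] leaf_small[OF leaf] by blast
    moreover have "ball x (\<epsilon> / (k * c) * hypotenuse t) \<subseteq> region (map_tile ?F ?T)" if x: "x \<in> region t" for x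
    proof
      fix y assume y: "y \<in> ball x (\<epsilon> / (k * c) * hypotenuse t)"
      obtain x0 where x0: "x0 \<in> region u" "x = ?F x0"
        using x region_map_tile[OF F, of u] unfolding Fu by blast
      obtain y0 where y0: "y = ?F y0"
        using similarity_inverse[OF F] by metis
      have "l / k * dist x0 y0 < \<epsilon> / (k * c) * (l * c)"
        using y F unfolding x0(2) y0 hypotenuse_right_tile[OF t] by (simp add: similarity_def)
      then have "dist x0 y0 < \<epsilon>"
        using k l c by (simp add: field_simps)
      then have "y0 \<in> region ?T"
        using ball[OF x0(1)] by auto
      then show "y \<in> region (map_tile ?F ?T)"
        unfolding region_map_tile[OF F] y0 by blast
    qed
    ultimately show ?thesis
      using tile_map_tile[OF tile_basic F] by blast
  qed
  then show ?thesis
    using that[of "\<epsilon> / (k * c)"] \<open>\<epsilon> > 0\<close> k c by simp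
qed

lemma increasing_tiles:
  obtains T where "\<And>k. tile (T k)" "\<And>k. c \<le> hypotenuse (T k)"
    "\<And>k. leaf (hypotenuse (T k)) (T (Suc k)) (T k)" "(\<Union>k. region (T k)) = UNIV"
proof -
  obtain \<delta> where "\<delta> > 0" and "\<And>t. tile t \<Longrightarrow> \<exists>t'. tile t' \<and> leaf (hypotenuse t) t' t \<and>
      (\<forall>x\<in>region t. ball x (\<delta> * hypotenuse t) \<subseteq> region t')"
    using tile_extension by blast
  then obtain G where G: "tile t \<Longrightarrow> tile (G t)" "tile t \<Longrightarrow> leaf (hypotenuse t) (G t) t"
      "tile t \<Longrightarrow> x \<in> region t \<Longrightarrow> ball x (\<delta> * hypotenuse t) \<subseteq> region (G t)" for t x
    by metis
  define T where "T k = (G ^^ k) (basic_tile a b)" for k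
  have T_Suc: "T (Suc k) = G (T k)" for k
    by (simp add: T_def)
  have tile: "tile (T k)" for k
    by (induction k) (simp_all add: T_Suc G(1), simp add: T_def tile_basic)
  have leaf: "leaf (hypotenuse (T k)) (T (Suc k)) (T k)" for k
    unfolding T_Suc by (rule G(2)[OF tile])
  have hyp: "c \<le> hypotenuse (T k)" for k
  proof (induction k)
    case 0
    then show ?case
      by (simp add: T_def hypotenuse_basic)
  next
    case (Suc k)
    then show ?case
      using leaf_hypotenuse_le[OF leaf tile, of k] by linarith
  qed
  obtain z where z: "z \<in> region (T 0)"
    by (cases "T 0") (auto intro: hull_inc)
  \<comment> \<open>Each extension adds a margin of at least \<open>\<delta> * c\<close>. Half of it
    is claimed, so that closed balls fit inside the open balls provided by \<open>G\<close>.\<close>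
  have ball: "cball z (k * (\<delta> * c / 2)) \<subseteq> region (T k)" for k :: nat
  proof (induction k)
    case (Suc k)
    define \<eta> where "\<eta> = \<delta> * c / 2"
    have "\<eta> > 0"
      using \<open>\<delta> > 0\<close> c by (simp add: \<eta>_def)
    have "y \<in> region (T (Suc k))" if y: "dist z y \<le> Suc k * \<eta>" for y
    proof -
      \<comment> \<open>This point of the segment from \<open>z\<close> to \<open>y\<close> is
        within \<open>k * \<eta>\<close> of \<open>z\<close> and within \<open>\<eta>\<close> of
        \<open>y\<close>.\<close>
      define x where "x = z + (k / Suc k) *\<^sub>R (y - z)"
      have "x - z = (k / Suc k) *\<^sub>R (y - z)" "y - x = (1 / Suc k) *\<^sub>R (y - z)"
        by (simp_all add: x_def vec_eq_iff field_simps)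
      then have "dist z x = k / Suc k * dist z y" "dist x y = 1 / Suc k * dist z y"
        by (simp_all add: dist_norm norm_minus_commute[of z] norm_minus_commute[of x])
      moreover have "k / Suc k * dist z y \<le> k / Suc k * (Suc k * \<eta>)"
        "1 / Suc k * dist z y \<le> 1 / Suc k * (Suc k * \<eta>)"
        using y by (intro mult_left_mono; simp)+
      ultimately have "dist z x \<le> k * \<eta>" "dist x y \<le> \<eta>"
        by simp_all
      then have "x \<in> region (T k)"
        using Suc.IH by (auto simp: \<eta>_def)
      moreover have "dist x y < \<delta> * hypotenuse (T k)"
      proof -
        have "\<delta> * c \<le> \<delta> * hypotenuse (T k)"
          using hyp[of k] \<open>\<delta> > 0\<close> by simp
        then show ?thesis
          using \<open>dist x y \<le> \<eta>\<close> \<open>\<eta> > 0\<close> unfolding \<eta>_def by linarith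
      qed
      ultimately show ?thesis
        using G(3)[OF tile, of x k] unfolding T_Suc by auto
    qed
    then show ?case
      by (auto simp: \<eta>_def)
  qed (use z in simp)
  have "y \<in> (\<Union>k. region (T k))" for y
  proof -
    have "\<delta> * c / 2 > 0"
      using \<open>\<delta> > 0\<close> c by simp
    then obtain k :: nat where "dist z y < k * (\<delta> * c / 2)"
      using reals_Archimedean3 by blast
    then have "y \<in> region (T k)"
      using ball[of k] by auto
    then show ?thesis
      by blast
  qed
  then show ?thesis
    using that tile hyp leaf by blast
qed

section \<open>The tiling and its properties\<close>

lemma area_bounds:
  assumes "tile t" "l \<le> hypotenuse t" "hypotenuse t \<le> u" "l \<ge> 0"
  shows "(l / c)\<^sup>2 * (a * b / 2) \<le> measure lborel (region t)"
    and "measure lborel (region t) \<le> (u / c)\<^sup>2 * (a * b / 2)"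
  unfolding area_right_tile[OF right_tile_hypotenuse[OF assms(1)]]
  using assms a b c by (intro mult_right_mono power_mono divide_right_mono; simp)+

lemma tiling_exists:
  "\<exists>X. tiling_of_plane X \<and>
     (\<forall>t\<in>X. is_tile a b c t) \<and>
     (\<forall>S. finite S \<and> S \<subseteq> X \<longrightarrow> (\<exists>n Y. supertile a b n Y \<and> S \<subseteq> Y \<and> Y \<subseteq> X)) \<and>
     (\<exists>l>0. \<exists>u. \<forall>t\<in>X. l \<le> measure lborel (region t) \<and> measure lborel (region t) \<le> u)"
proof -
  obtain T where tile: "\<And>k. tile (T k)" and hyp: "\<And>k. c \<le> hypotenuse (T k)"
    and leaf: "\<And>k. leaf (hypotenuse (T k)) (T (Suc k)) (T k)"
    and cover: "(\<Union>k. region (T k)) = UNIV"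
    using increasing_tiles by blast
  define X where "X = (\<Union>k. {u. leaf c (T k) u})"
  \<comment> \<open>\<open>T k\<close> is a leaf of its successor at a threshold of at least
    \<open>c\<close>, so \<open>leaf_trans\<close> applies. Hence finitely many tiles of
    \<open>X\<close> always lie in one common stage, which is a supertile.\<close>
  have mono: "leaf c (T m) u" if "leaf c (T k) u" "k \<le> m" for k m u
    using that(2,1) by (induction rule: dec_induct) (auto intro: leaf_trans[OF leaf _ hyp])
  have X_tile: "tile u" if "u \<in> X" for u
    using that leaf_tile tile unfolding X_def by blast
  have "tiling_of_plane X"
    unfolding tiling_of_plane_def
  proof
    show "(\<Union>t\<in>X. region t) = UNIV"
    proof (intro equalityI subset_UNIV subsetI)
      fix x
      obtain k where "x \<in> region (T k)"
        using cover by blast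
      then show "x \<in> (\<Union>t\<in>X. region t)"
        using leaves_cover[OF tile _ c] unfolding X_def by blast
    qed
    show "pairwise (\<lambda>s t. interior (region s) \<inter> interior (region t) = {}) X"
    proof (rule pairwiseI)
      fix u v assume "u \<in> X" "v \<in> X" "u \<noteq> v"
      then obtain j k where "leaf c (T j) u" "leaf c (T k) v"
        unfolding X_def by blast
      then have "leaf c (T (max j k)) u" "leaf c (T (max j k)) v"
        using mono by (meson max.cobounded1 max.cobounded2)+
      then show "interior (region u) \<inter> interior (region v) = {}"
        using leaves_disjoint tile \<open>u \<noteq> v\<close> by blast
    qed
  qed
  moreover have "is_tile a b c u" if "u \<in> X" for u
    using X_tile[OF that] is_tile_right unfolding tile_def by blast
  moreover have "\<exists>n Y. supertile a b n Y \<and> S \<subseteq> Y \<and> Y \<subseteq> X" if "finite S" "S \<subseteq> X" for S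
  proof -
    have "\<exists>k. \<forall>u\<in>S. leaf c (T k) u"
      using that
    proof (induction S)
      case (insert v S)
      then obtain j k where "\<forall>u\<in>S. leaf c (T j) u" "leaf c (T k) v"
        unfolding X_def by blast
      then have "\<forall>u\<in>insert v S. leaf c (T (max j k)) u"
        using mono by (metis insert_iff max.cobounded1 max.cobounded2)
      then show ?case
        by blast
    qed simp
    then obtain k where "S \<subseteq> {u. leaf c (T k) u}"
      by blast
    moreover obtain n where "supertile a b n {u. leaf c (T k) u}"
      using supertile_leaves[OF tile c] by blast
    ultimately show ?thesis
      unfolding X_def by blast
  qed
  moreover have "\<exists>l>0. \<exists>u. \<forall>t\<in>X. l \<le> measure lborel (region t) \<and> measure lborel (region t) \<le> u"
  proof -
    have min: "0 < Min ratios" "Min ratios < 1"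
      using a b c ratios_bounds by (auto simp: ratios_def min_def)
    have "Min ratios * c \<le> hypotenuse u \<and> hypotenuse u \<le> c" if "u \<in> X" for u
    proof -
      obtain k where k: "leaf c (T k) u"
        using \<open>u \<in> X\<close> unfolding X_def by blast
      have "Min ratios * c \<le> c"
        using min c by simp
      \<comment> \<open>A leaf equal to \<open>T k\<close> escapes the parent argument, but then its
        hypotenuse is at least \<open>c\<close>.\<close>
      then have "Min ratios * c \<le> hypotenuse u"
        using leaf_hypotenuse_lower[OF k tile] hyp[of k] by (cases "u = T k") auto
      then show ?thesis
        using leaf_small[OF k] by blast
    qed
    then have "(Min ratios * c / c)\<^sup>2 * (a * b / 2) \<le> measure lborel (region u)"
      "measure lborel (region u) \<le> (c / c)\<^sup>2 * (a * b / 2)" if "u \<in> X" for u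
      using area_bounds[OF X_tile[OF that], of "Min ratios * c" c] that min c by simp_all
    moreover have "(Min ratios * c / c)\<^sup>2 * (a * b / 2) > 0"
      using min a b c by simp
    ultimately show ?thesis
      by blast
  qed
  ultimately show ?thesis
    by blast
qed

end

theorem theorem1:
  fixes a b c :: real
  assumes "a > 0" and "b > 0" and "c > 0" and "a\<^sup>2 + b\<^sup>2 = c\<^sup>2"
  shows "\<exists>X. tiling_of_plane X \<and>
             (\<forall>t\<in>X. is_tile a b c t) \<and>
             (\<forall>S. finite S \<and> S \<subseteq> X \<longrightarrow> (\<exists>n Y. supertile a b n Y \<and> S \<subseteq> Y \<and> Y \<subseteq> X)) \<and>
             (\<exists>l>0. \<exists>u. \<forall>t\<in>X. l \<le> measure lborel (region t) \<and> measure lborel (region t) \<le> u)"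
proof -
  interpret right_triangle a b c
    using assms by unfold_locales
  show ?thesis
    by (rule tiling_exists)
qed

end
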